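(* Let $r\geq 11$ be an integer and let $t$ be a non-negative integer. Then $J(C_3,r)\cup tP_3$ is antimagic if and only if $t\leq 6r+22$. Equivalently, $\beta(J(C_3,r))=\tau(J(C_3,r))$ for $r\geq 11$.
   Context: Graphs are finite and simple, not necessarily connected. For a graph $G$ with $m$ edges and a bijection $f: E(G)\to\{1,2,\dots,m\}$, let $\phi_f(v)$ be the sum of $f(e)$ over all edges $e$ incident to the vertex $v$. The bijection $f$ is an antimagic labeling of $G$ if $\phi_f(u)\neq\phi_f(v)$ for all pairs of distinct vertices $u,v$; $G$ is antimagic if it admits an antimagic labeling. $P_j$ is the path on $j$ vertices, $C_j$ the cycle on $j$ vertices. $G\cup H$ denotes disjoint union, and $tG$ the disjoint union of $t$ copies of $G$. For positive integers $r$ and $k$ with $k\geq 3$, the jellyfish graph $J(C_k,r)$ is obtained from the cycle $C_k$ by attaching $r$ pendant edges (each with a new leaf) to each vertex of $C_k$. If $G$ is antimagic, $\tau(G)$ is the maximum non-negative integer $t$ such that $G\cup t'P_3$ is antimagic for all integers $0\leq t'\leq t$; if $G$ is not antimagic, $\tau(G)=-\infty$. An edge is internal if both of its ends are non-leaf vertices. For a graph $G$ without isolated vertices and without $P_2$ as a component, having $n$ vertices, $m$ edges, $k$ internal edges, and $t'$ components isomorphic to $P_3$, $$\beta(G) = \left\lfloor\min \left\{ (3 + 2\sqrt{2})(m -n)+(1 + \sqrt{2})\left(m +\tfrac{1}{2}\right), \ 2m + 5(k-t') +1 \right\} \right\rfloor.$$ *)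

theory Defs
  imports Complex_Main "HOL-Library.Extended_Real"
begin

text \<open>
  A graph is a vertex set with a set of edges, each edge being a set of vertices.
  The operations below are total on this record type; \<open>simple_graph\<close> singles out the finite
  simple graphs, and all constructions are shown to produce such graphs.
\<close>

record 'a sgraph =
  verts :: "'a set"
  edges :: "'a set set"

definition simple_graph :: "'a sgraph \<Rightarrow> bool" where
  "simple_graph G \<longleftrightarrow> finite (verts G) \<and> (\<forall>e\<in>edges G. e \<subseteq> verts G \<and> card e = 2)"

definition degree :: "'a sgraph \<Rightarrow> 'a \<Rightarrow> nat" where
  "degree G v = card {e \<in> edges G. v \<in> e}"

definition internal_edges :: "'a sgraph \<Rightarrow> 'a set set" where
  "internal_edges G = {e \<in> edges G. \<forall>v\<in>e. degree G v \<noteq> 1}"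

definition isomorphic :: "'a sgraph \<Rightarrow> 'b sgraph \<Rightarrow> bool" where
  "isomorphic G H \<longleftrightarrow>
     (\<exists>h. bij_betw h (verts G) (verts H) \<and> (\<lambda>e. h ` e) ` edges G = edges H)"

definition induced_subgraph :: "'a sgraph \<Rightarrow> 'a set \<Rightarrow> 'a sgraph" where
  "induced_subgraph G S = \<lparr>verts = S, edges = {e \<in> edges G. e \<subseteq> S}\<rparr>"

definition adj_rel :: "'a sgraph \<Rightarrow> ('a \<times> 'a) set" where
  "adj_rel G = {(u, v). {u, v} \<in> edges G}"

definition components :: "'a sgraph \<Rightarrow> 'a sgraph set" where
  "components G = (\<lambda>v. induced_subgraph G ((adj_rel G)\<^sup>* `` {v})) ` verts G"


subsection \<open>Constructions\<close>

definition path_graph :: "nat \<Rightarrow> nat sgraph" where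
  "path_graph j = \<lparr>verts = {..<j}, edges = {{i, Suc i} | i. Suc i < j}\<rparr>"

text \<open>Intended for \<open>k \<ge> 3\<close> only.\<close>

definition cycle_graph :: "nat \<Rightarrow> nat sgraph" where
  "cycle_graph k = \<lparr>verts = {..<k}, edges = {{i, Suc i mod k} | i. i < k}\<rparr>"

definition disjoint_union :: "'a sgraph \<Rightarrow> 'b sgraph \<Rightarrow> ('a + 'b) sgraph" where
  "disjoint_union G H =
     \<lparr>verts = verts G <+> verts H,
      edges = (\<lambda>e. Inl ` e) ` edges G \<union> (\<lambda>e. Inr ` e) ` edges H\<rparr>"

definition copies :: "nat \<Rightarrow> 'a sgraph \<Rightarrow> (nat \<times> 'a) sgraph" where
  "copies t G =
     \<lparr>verts = {..<t} \<times> verts G, edges = {Pair i ` e | i e. i < t \<and> e \<in> edges G}\<rparr>"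

text \<open>The leaf \<open>Inr (v, j)\<close> is the \<open>j\<close>-th new leaf attached to the vertex \<open>v\<close>.\<close>

definition attach_leaves :: "'a sgraph \<Rightarrow> nat \<Rightarrow> ('a + 'a \<times> nat) sgraph" where
  "attach_leaves G r =
     \<lparr>verts = verts G <+> verts G \<times> {..<r},
      edges = (\<lambda>e. Inl ` e) ` edges G
              \<union> {{Inl v, Inr (v, j)} | v j. v \<in> verts G \<and> j < r}\<rparr>"

definition jellyfish :: "nat \<Rightarrow> nat \<Rightarrow> (nat + nat \<times> nat) sgraph" where
  "jellyfish k r = attach_leaves (cycle_graph k) r"


subsection \<open>Antimagic labelings\<close>

definition vertex_sum :: "'a sgraph \<Rightarrow> ('a set \<Rightarrow> nat) \<Rightarrow> 'a \<Rightarrow> nat" where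
  "vertex_sum G f v = (\<Sum>e | e \<in> edges G \<and> v \<in> e. f e)"

definition antimagic_labeling :: "'a sgraph \<Rightarrow> ('a set \<Rightarrow> nat) \<Rightarrow> bool" where
  "antimagic_labeling G f \<longleftrightarrow>
     bij_betw f (edges G) {1..card (edges G)} \<and>
     (\<forall>u\<in>verts G. \<forall>v\<in>verts G. u \<noteq> v \<longrightarrow> vertex_sum G f u \<noteq> vertex_sum G f v)"

definition antimagic :: "'a sgraph \<Rightarrow> bool" where
  "antimagic G \<longleftrightarrow> (\<exists>f. antimagic_labeling G f)"

definition tau :: "'a sgraph \<Rightarrow> ereal" where
  "tau G =
     (if antimagic G
      then ereal (real (GREATEST t. \<forall>t'\<le>t. antimagic (disjoint_union G (copies t' (path_graph 3)))))
      else -\<infinity>)"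

text \<open>
  \<open>beta\<close> is meant for simple graphs without isolated vertices and without \<open>path_graph 2\<close> as a
  component. The difference \<open>k - t'\<close> is taken in the reals, hence not truncated.
\<close>

definition beta :: "'a sgraph \<Rightarrow> int" where
  "beta G =
     (let n = real (card (verts G));
          m = real (card (edges G));
          k = real (card (internal_edges G));
          t' = real (card {C \<in> components G. isomorphic C (path_graph 3)})
      in \<lfloor>min ((3 + 2 * sqrt 2) * (m - n) + (1 + sqrt 2) * (m + 1 / 2))
              (2 * m + 5 * (k - t') + 1)\<rfloor>)"


subsection \<open>Well-formedness\<close>

lemma simple_graph_path_graph: "simple_graph (path_graph j)"
  by (auto simp: simple_graph_def path_graph_def card_insert_if)

lemma simple_graph_cycle_graph:
  assumes "k \<ge> 3"
  shows "simple_graph (cycle_graph k)"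
proof -
  have "i \<noteq> Suc i mod k" if "i < k" for i
    using assms that by (cases "Suc i = k") auto
  then show ?thesis
    using assms by (auto simp: simple_graph_def cycle_graph_def card_insert_if)
qed

lemma simple_graph_disjoint_union:
  assumes "simple_graph G" "simple_graph H"
  shows "simple_graph (disjoint_union G H)"
  using assms by (auto simp: simple_graph_def disjoint_union_def card_image)

lemma simple_graph_copies:
  assumes "simple_graph G"
  shows "simple_graph (copies t G)"
  using assms by (auto simp: simple_graph_def copies_def card_image inj_on_def)

lemma simple_graph_attach_leaves:
  assumes "simple_graph G"
  shows "simple_graph (attach_leaves G r)"
  using assms by (auto simp: simple_graph_def attach_leaves_def card_image)

lemma simple_graph_jellyfish: "k \<ge> 3 \<Longrightarrow> simple_graph (jellyfish k r)"
  by (simp add: jellyfish_def simple_graph_attach_leaves simple_graph_cycle_graph)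

lemma pendant_edge:
  "v \<in> verts G \<Longrightarrow> j < r \<Longrightarrow> {Inl v, Inr (v, j)} \<in> edges (attach_leaves G r)"
  unfolding attach_leaves_def sgraph.select_convs by blast

lemma cycle_edge: "i < k \<Longrightarrow> {i, Suc i mod k} \<in> edges (cycle_graph k)"
  unfolding cycle_graph_def sgraph.select_convs by blast

lemma verts_jellyfish: "verts (jellyfish k r) = {..<k} <+> {..<k} \<times> {..<r}"
  by (simp add: jellyfish_def attach_leaves_def cycle_graph_def)

lemma pendant_edge_jellyfish:
  "i < k \<Longrightarrow> j < r \<Longrightarrow> {Inl i, Inr (i, j)} \<in> edges (jellyfish k r)"
  unfolding jellyfish_def by (rule pendant_edge) (simp_all add: cycle_graph_def)

lemma jellyfish_no_isolated_vertex:
  assumes "k \<ge> 3" "r \<ge> 1" "v \<in> verts (jellyfish k r)"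
  shows "degree (jellyfish k r) v \<noteq> 0"
proof -
  let ?G = "jellyfish k r"
  have "\<forall>e\<in>edges ?G. e \<subseteq> verts ?G" "finite (verts ?G)"
    using simple_graph_jellyfish[OF assms(1)] by (auto simp: simple_graph_def)
  then have fin: "finite (edges ?G)"
    by (meson Pow_iff finite_Pow_iff finite_subset subsetI)
  have "\<exists>e\<in>edges ?G. v \<in> e"
  proof (cases v)
    case (Inl i)
    then have "{v, Inr (i, 0)} \<in> edges ?G"
      using assms by (auto simp: verts_jellyfish intro: pendant_edge_jellyfish)
    then show ?thesis by blast
  next
    case (Inr p)
    obtain i j where p: "p = (i, j)" by fastforce
    then have "{Inl i, v} \<in> edges ?G"
      using assms Inr by (auto simp: verts_jellyfish intro: pendant_edge_jellyfish)
    then show ?thesis by blast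
  qed
  with fin show ?thesis
    by (auto simp: degree_def card_eq_0_iff)
qed

lemma jellyfish_no_P2_component:
  assumes "k \<ge> 3" "r \<ge> 1" "C \<in> components (jellyfish k r)"
  shows "\<not> isomorphic C (path_graph 2)"
proof
  let ?G = "jellyfish k r"
  assume iso: "isomorphic C (path_graph 2)"
  obtain v where v: "v \<in> verts ?G" and C: "verts C = (adj_rel ?G)\<^sup>* `` {v}"
    using assms(3) by (auto simp: components_def induced_subgraph_def)
  obtain h :: "nat + nat \<times> nat \<Rightarrow> nat" where "bij_betw h (verts C) {..<2}"
    using iso by (auto simp: isomorphic_def path_graph_def)
  then have two: "finite (verts C)" "card (verts C) = 2"
    using bij_betw_finite bij_betw_same_card by fastforce+
  have "\<exists>i<k. (v, Inl i) \<in> (adj_rel ?G)\<^sup>*"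
  proof (cases v)
    case (Inl i)
    then show ?thesis
      using v by (auto simp: verts_jellyfish)
  next
    case (Inr p)
    obtain i j where p: "p = (i, j)" by fastforce
    then have "i < k" "j < r"
      using v Inr by (auto simp: verts_jellyfish)
    then have "(v, Inl i) \<in> adj_rel ?G"
      using pendant_edge_jellyfish[of i k j r] Inr p by (simp add: adj_rel_def insert_commute)
    with \<open>i < k\<close> show ?thesis by blast
  qed
  then obtain i where i: "i < k" "(v, Inl i) \<in> (adj_rel ?G)\<^sup>*" by blast
  have "Inl ` {i, Suc i mod k} \<in> edges ?G"
    using cycle_edge[OF i(1)] unfolding jellyfish_def attach_leaves_def sgraph.select_convs by blast
  then have "(Inl i, Inl (Suc i mod k)) \<in> adj_rel ?G"
    by (simp add: adj_rel_def)
  moreover have "(Inl i, Inr (i, 0)) \<in> adj_rel ?G"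
    using pendant_edge_jellyfish[of i k 0 r] i(1) assms(2) by (simp add: adj_rel_def)
  ultimately have sub: "{Inl i, Inl (Suc i mod k), Inr (i, 0)} \<subseteq> verts C"
    using i(2) unfolding C by (auto intro: rtrancl_into_rtrancl)
  have "i \<noteq> Suc i mod k"
    using assms(1) i(1) by (cases "Suc i = k") auto
  then have "card {Inl i, Inl (Suc i mod k), Inr (i, 0) :: nat + nat \<times> nat} = 3"
    by simp
  then show False
    using card_mono[OF two(1) sub] two(2) by simp
qed

end

theory Submission
  imports Defs
begin

text \<open>
  Call the three vertices of the triangle hubs, and the middle vertex of a copy of the path its
  centre. Write \<open>M = 3 * r + 3 + 2 * t\<close> for the number of edges. Every leaf has a label as its sum,
  and every label of an edge other than the three triangle edges occurs as the sum of a leaf.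

  Necessity (\<open>antimagic_naming_bound\<close>). The sum at a centre is therefore either one of the three
  triangle labels or larger than \<open>M\<close>. So all but at most three centres have distinct sums
  beyond \<open>M\<close>. If there are \<open>n\<close> such centres, their sums add up to at least
  \<open>(M + 1) + \<dots> + (M + n)\<close>, but they are made of \<open>2 * n\<close> distinct labels, which add up to at most
  \<open>M + (M - 1) + \<dots> + (M - 2 * n + 1)\<close>. The two bounds give \<open>5 * n \<le> 2 * M + 1\<close>, which
  with \<open>t \<le> n + 3\<close> is \<open>t \<le> 6 * r + 22\<close>.

  Sufficiency (\<open>antimagic_naming_extend\<close>). The extremal case of the count shows what a labeling has
  to look like: three paths have the triangle labels as the sums at their centres, they and the
  jellyfish use up the smallest labels \<open>1, \<dots>, L\<close>, where \<open>L = 3 * r + 9\<close>, and the remaining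
  \<open>n = t - 3\<close> paths use the labels \<open>L + 1, \<dots>, L + 2 * n\<close> in pairs with sums that are distinct and
  as equal as possible. The function \<open>partner\<close> gives such pairs; their sums exceed
  \<open>M\<close> exactly as long as \<open>n \<le> 2 * L + 1\<close>, that is \<open>t \<le> 6 * r + 22\<close>.
  The largest of these sums is at most \<open>7 * L + 3\<close>, so it remains to label the jellyfish such that
  the hubs have distinct sums above \<open>7 * L + 3\<close>. The three hub sums add up to \<open>L * (L + 1) / 2\<close>,
  whatever the labeling of the core. For \<open>r = 11\<close> this is \<open>903\<close>, whereas each of them should be
  at least \<open>298\<close>, so the pendant labels must be shared out almost equally; \<open>balanced_core\<close> does this,
  and for larger \<open>r\<close> the hub sums grow quadratically. With at most two paths there is no need for
  small centre sums, and \<open>sequential_core\<close> is a labeling of the jellyfish alone to start from.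

  For the second claim, \<open>11\<close> is the smallest \<open>r\<close> for which the integral second term
  \<open>6 * r + 22\<close> is the minimum in the definition of \<open>beta\<close>.
\<close>

section \<open>Naming the edges\<close>

text \<open>
  The antimagic property is moved from sets of vertices to names of edges, where a labeling can be
  defined by cases and vertex sums are explicit expressions.
\<close>

abbreviation jellyfish_paths :: "nat \<Rightarrow> nat \<Rightarrow> ((nat + nat \<times> nat) + nat \<times> nat) sgraph" where
  "jellyfish_paths r t \<equiv> disjoint_union (jellyfish 3 r) (copies t (path_graph 3))"

text \<open>
  \<open>Cyc i\<close> is the triangle edge from hub \<open>i\<close> to the next one, \<open>Pend i j\<close> the edge to the \<open>j\<close>-th leaf at
  hub \<open>i\<close>, and \<open>Arm c k\<close> the edge \<open>{k, k + 1}\<close> of the \<open>c\<close>-th path.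
\<close>

datatype edge_name = Cyc nat | Pend nat nat | Arm nat nat

definition pendants :: "nat \<Rightarrow> edge_name set" where
  "pendants r = case_prod Pend ` ({..<3} \<times> {..<r})"

definition arms :: "nat set \<Rightarrow> edge_name set" where
  "arms C = case_prod Arm ` (C \<times> {..<2})"

definition names :: "nat \<Rightarrow> nat \<Rightarrow> edge_name set" where
  "names r t = Cyc ` {..<3} \<union> pendants r \<union> arms {..<t}"

fun edge_of :: "edge_name \<Rightarrow> ((nat + nat \<times> nat) + nat \<times> nat) set" where
  "edge_of (Cyc i) = Inl ` Inl ` {i, Suc i mod 3}"
| "edge_of (Pend i j) = Inl ` {Inl i, Inr (i, j)}"
| "edge_of (Arm c k) = Inr ` Pair c ` {k, Suc k}"

text \<open>
  Hub \<open>i\<close> is joined to the previous hub by the edge \<open>Cyc ((i + 2) mod 3)\<close>.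
\<close>

definition hub_sum :: "nat \<Rightarrow> (edge_name \<Rightarrow> nat) \<Rightarrow> nat \<Rightarrow> nat" where
  "hub_sum r g i = g (Cyc i) + g (Cyc ((i + 2) mod 3)) + (\<Sum>j<r. g (Pend i j))"

definition centre_sum :: "(edge_name \<Rightarrow> nat) \<Rightarrow> nat \<Rightarrow> nat" where
  "centre_sum g c = g (Arm c 0) + g (Arm c 1)"

lemma lessThan_3: "{..<3::nat} = {0, 1, 2}" by auto
lemma lessThan_2: "{..<2::nat} = {0, 1}" by auto

lemma arms_Un: "arms (A \<union> B) = arms A \<union> arms B"
  by (auto simp: arms_def)

lemma finite_arms: "finite C \<Longrightarrow> finite (arms C)"
  by (simp add: arms_def)

lemma card_arms: "card (arms C) = 2 * card C"
proof -
  have "inj_on (case_prod Arm) (C \<times> {..<2})" by (auto simp: inj_on_def)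
  then show ?thesis by (simp add: arms_def card_image card_cartesian_product)
qed

lemma card_pendants: "card (pendants r) = 3 * r"
proof -
  have "inj_on (case_prod Pend) ({..<3} \<times> {..<r})" by (auto simp: inj_on_def)
  then show ?thesis by (simp add: pendants_def card_image card_cartesian_product)
qed

lemma card_names: "card (names r t) = 3 * r + 3 + 2 * t"
proof -
  have "card (Cyc ` {..<3}) = 3" by (simp add: card_image inj_on_def)
  moreover have "card (Cyc ` {..<3} \<union> pendants r \<union> arms {..<t})
      = card (Cyc ` {..<3}) + card (pendants r) + card (arms {..<t})"
    by (subst card_Un_disjoint | force simp: pendants_def arms_def)+
  ultimately show ?thesis
    by (simp add: names_def card_pendants card_arms)
qed

lemma edges_path3: "edges (path_graph 3) = {{0, 1}, {1, 2}}"
  by (auto simp: path_graph_def numeral_3_eq_3 less_Suc_eq numeral_2_eq_2)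

lemma edges_copies: "edges (copies t (path_graph 3)) = (\<lambda>(c, k). Pair c ` {k, Suc k}) ` ({..<t} \<times> {..<2})"
proof -
  have "edges (path_graph 3) = (\<lambda>k. {k, Suc k}) ` {..<2}"
    by (auto simp: edges_path3 lessThan_2 numeral_2_eq_2)
  moreover have "{Pair c ` e | c e. c < t \<and> e \<in> h ` {..<2}} =
      (\<lambda>(c, k). Pair c ` h k) ` ({..<t} \<times> {..<2})" for h :: "nat \<Rightarrow> nat set"
    by auto
  ultimately show ?thesis
    unfolding copies_def sgraph.select_convs by (simp del: image_insert)
qed

lemma edges_jellyfish: "edges (jellyfish 3 r) = (\<lambda>i. Inl ` {i, Suc i mod 3}) ` {..<3} \<union>
    (\<lambda>(i, j). {Inl i, Inr (i, j)}) ` ({..<3} \<times> {..<r})"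
proof -
  have cycle: "edges (cycle_graph 3) = (\<lambda>i. {i, Suc i mod 3}) ` {..<3}"
    unfolding cycle_graph_def sgraph.select_convs by blast
  have "{{Inl v, Inr (v, j)} | v j. v \<in> verts (cycle_graph 3) \<and> j < r} =
      (\<lambda>(i, j). {Inl i, Inr (i, j)}) ` ({..<3} \<times> {..<r})"
    by (auto simp: cycle_graph_def)
  then show ?thesis
    unfolding jellyfish_def attach_leaves_def sgraph.select_convs cycle image_image by simp
qed

lemma edges_jellyfish_paths: "edges (jellyfish_paths r t) = edge_of ` names r t"
  unfolding disjoint_union_def sgraph.select_convs edges_copies edges_jellyfish names_def
    pendants_def arms_def image_Un image_image
  by (simp add: image_image case_prod_beta' Un_assoc)

lemma verts_jellyfish_paths: "verts (jellyfish_paths r t) =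
    Inl ` Inl ` {..<3} \<union> Inl ` Inr ` ({..<3} \<times> {..<r}) \<union> Inr ` ({..<t} \<times> {..<3})"
  by (auto simp: disjoint_union_def copies_def path_graph_def verts_jellyfish)

text \<open>
  Injectivity holds on all names, even those that do not name an edge: for \<open>i \<ge> 3\<close> the set
  \<open>{i, Suc i mod 3}\<close> still determines \<open>i\<close> as its only element above \<open>2\<close>. This makes
  \<open>inv edge_of\<close> a left inverse without side conditions.
\<close>

lemma inj_edge_of: "inj edge_of"
proof (rule injI)
  have cyc: "i = i'" if "{i, Suc i mod 3} = {i', Suc i' mod 3}" for i i' :: nat
  proof (rule ccontr)
    assume "i \<noteq> i'"
    then have *: "i = Suc i' mod 3" "i' = Suc i mod 3"
      using that by (auto simp: doubleton_eq_iff)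
    then have "i = Suc (Suc i mod 3) mod 3" by metis
    moreover have "i < 3" by (subst *(1)) simp
    then have "i = 0 \<or> i = 1 \<or> i = 2" by linarith
    ultimately show False by auto
  qed
  have arm: "c = c' \<and> k = k'" if "Pair c ` {k, Suc k} = Pair c' ` {k', Suc k'}" for c k c' k' :: nat
    using that by (auto simp: doubleton_eq_iff)
  have pend: "i = i' \<and> j = j'"
    if "{Inl i, Inr (i, j)} = {Inl i', Inr (i', j') :: nat + nat \<times> nat}" for i j i' j'
    using that by (auto simp: doubleton_eq_iff)
  fix x y assume "edge_of x = edge_of y"
  then show "x = y"
    by (cases x; cases y) (auto simp: inj_image_eq_iff image_iff simp del: image_insert dest: cyc arm pend)
qed

lemma vertex_sum_named:
  assumes "N \<subseteq> names r t" "\<And>x. x \<in> names r t \<Longrightarrow> v \<in> edge_of x \<longleftrightarrow> x \<in> N"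
  shows "vertex_sum (jellyfish_paths r t) f v = sum (f \<circ> edge_of) N"
proof -
  have "{e. e \<in> edges (jellyfish_paths r t) \<and> v \<in> e} = edge_of ` N"
    using assms by (auto simp: edges_jellyfish_paths)
  moreover have "inj_on edge_of N"
    using inj_on_subset[OF inj_edge_of] by blast
  ultimately show ?thesis
    by (simp add: vertex_sum_def sum.reindex)
qed

lemma vertex_sum_hub:
  assumes "i < 3"
  shows "vertex_sum (jellyfish_paths r t) f (Inl (Inl i)) = hub_sum r (f \<circ> edge_of) i"
proof -
  let ?C = "{Cyc i, Cyc ((i + 2) mod 3)}" and ?P = "Pend i ` {..<r}"
  have i: "i = 0 \<or> i = 1 \<or> i = 2" using assms by linarith
  then have "vertex_sum (jellyfish_paths r t) f (Inl (Inl i)) = sum (f \<circ> edge_of) (?C \<union> ?P)"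
    by (intro vertex_sum_named) (auto simp: names_def pendants_def arms_def lessThan_3)
  also have "\<dots> = sum (f \<circ> edge_of) ?C + sum (f \<circ> edge_of) ?P"
    by (rule sum.union_disjoint) auto
  also have "\<dots> = hub_sum r (f \<circ> edge_of) i"
    using i by (auto simp: hub_sum_def sum.reindex inj_on_def)
  finally show ?thesis .
qed

lemma vertex_sum_leaf:
  assumes "i < 3" "j < r"
  shows "vertex_sum (jellyfish_paths r t) f (Inl (Inr (i, j))) = f (edge_of (Pend i j))"
proof -
  have "vertex_sum (jellyfish_paths r t) f (Inl (Inr (i, j))) = sum (f \<circ> edge_of) {Pend i j}"
    by (rule vertex_sum_named) (use assms in \<open>auto simp: names_def pendants_def arms_def\<close>)
  then show ?thesis by simp
qed

lemma vertex_sum_path: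
  assumes "c < t"
  shows "vertex_sum (jellyfish_paths r t) f (Inr (c, 0)) = f (edge_of (Arm c 0))" (is ?A)
    and "vertex_sum (jellyfish_paths r t) f (Inr (c, 1)) = centre_sum (f \<circ> edge_of) c" (is ?B)
    and "vertex_sum (jellyfish_paths r t) f (Inr (c, 2)) = f (edge_of (Arm c 1))" (is ?C)
proof -
  have "vertex_sum (jellyfish_paths r t) f (Inr (c, 0)) = sum (f \<circ> edge_of) {Arm c 0}"
    by (rule vertex_sum_named) (use assms in \<open>auto simp: names_def pendants_def arms_def\<close>)
  then show ?A by simp
  have "vertex_sum (jellyfish_paths r t) f (Inr (c, 1)) = sum (f \<circ> edge_of) {Arm c 0, Arm c 1}"
    by (rule vertex_sum_named) (use assms in \<open>auto simp: names_def pendants_def arms_def lessThan_2\<close>)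
  then show ?B by (simp add: centre_sum_def)
  have "vertex_sum (jellyfish_paths r t) f (Inr (c, 2)) = sum (f \<circ> edge_of) {Arm c 1}"
    by (rule vertex_sum_named) (use assms in \<open>auto simp: names_def pendants_def arms_def lessThan_2\<close>)
  then show ?C by simp
qed

definition leaves :: "nat \<Rightarrow> nat \<Rightarrow> edge_name set" where
  "leaves r t = pendants r \<union> arms {..<t}"

text \<open>
  The sums at leaves are labels, so that their distinctness is contained in the bijectivity.
\<close>

definition antimagic_naming :: "nat \<Rightarrow> nat \<Rightarrow> (edge_name \<Rightarrow> nat) \<Rightarrow> bool" where
  "antimagic_naming r t g \<longleftrightarrow>
     bij_betw g (names r t) {1..3 * r + 3 + 2 * t} \<and>
     inj_on (hub_sum r g) {..<3} \<and> inj_on (centre_sum g) {..<t} \<and>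
     hub_sum r g ` {..<3} \<inter> centre_sum g ` {..<t} = {} \<and>
     (hub_sum r g ` {..<3} \<union> centre_sum g ` {..<t}) \<inter> g ` leaves r t = {}"

lemma leaves_subset_names: "leaves r t \<subseteq> names r t"
  by (auto simp: names_def leaves_def)

text \<open>
  An arm \<open>k \<in> {0, 1}\<close> ends in the vertex \<open>2 * k\<close> of its path. A triangle edge has no leaf;
  \<open>Inl (Inl i)\<close> is a default value there.
\<close>

fun leaf_of :: "edge_name \<Rightarrow> (nat + nat \<times> nat) + nat \<times> nat" where
  "leaf_of (Cyc i) = Inl (Inl i)"
| "leaf_of (Pend i j) = Inl (Inr (i, j))"
| "leaf_of (Arm c k) = Inr (c, 2 * k)"

lemma verts_by_kind: "verts (jellyfish_paths r t) =
    (\<lambda>i. Inl (Inl i)) ` {..<3} \<union> (\<lambda>c. Inr (c, 1)) ` {..<t} \<union> leaf_of ` leaves r t"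
  unfolding verts_jellyfish_paths leaves_def pendants_def arms_def lessThan_3 lessThan_2 image_Un image_image
  by (auto simp: image_iff)

text \<open>
  Vertex sums on the three kinds of vertices are functions of an index; this transfers injectivity
  and image along the parametrization.
\<close>

lemma reparametrize:
  assumes "inj_on h A" "\<And>x. x \<in> A \<Longrightarrow> f (h x) = q x"
  shows "inj_on f (h ` A) \<longleftrightarrow> inj_on q A" "f ` h ` A = q ` A"
proof -
  have "inj_on f (h ` A) \<longleftrightarrow> inj_on (f \<circ> h) A"
    using assms(1) by (rule comp_inj_on_iff)
  also have "\<dots> \<longleftrightarrow> inj_on q A"
    using assms(2) by (intro inj_on_cong) simp
  finally show "inj_on f (h ` A) \<longleftrightarrow> inj_on q A" .
  show "f ` h ` A = q ` A"
    unfolding image_image using assms(2) by (rule image_cong[OF refl])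
qed

lemma antimagic_labeling_iff:
  "antimagic_labeling (jellyfish_paths r t) f \<longleftrightarrow> antimagic_naming r t (f \<circ> edge_of)"
proof -
  let ?G = "jellyfish_paths r t" and ?g = "f \<circ> edge_of"
  let ?S = "vertex_sum ?G f"
  let ?H = "(\<lambda>i. Inl (Inl i)) ` {..<3} :: ((nat + nat \<times> nat) + nat \<times> nat) set"
  let ?K = "(\<lambda>c. Inr (c, 1)) ` {..<t} :: ((nat + nat \<times> nat) + nat \<times> nat) set"
  let ?L = "leaf_of ` leaves r t"
  have inj: "inj_on edge_of A" for A
    using inj_edge_of inj_on_subset by blast
  have bij: "bij_betw f (edges ?G) {1..card (edges ?G)} \<longleftrightarrow>
      bij_betw ?g (names r t) {1..3 * r + 3 + 2 * t}"
    unfolding edges_jellyfish_paths card_image[OF inj] card_names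
    by (rule bij_betw_comp_iff) (simp add: bij_betw_def inj)
  have H: "inj_on ?S ?H \<longleftrightarrow> inj_on (hub_sum r ?g) {..<3}" "?S ` ?H = hub_sum r ?g ` {..<3}"
    by (rule reparametrize, simp add: inj_on_def, simp add: vertex_sum_hub)+
  have K: "inj_on ?S ?K \<longleftrightarrow> inj_on (centre_sum ?g) {..<t}" "?S ` ?K = centre_sum ?g ` {..<t}"
    by (rule reparametrize, simp add: inj_on_def, rule vertex_sum_path(2), simp)+
  have leaf: "?S (leaf_of x) = ?g x" if x: "x \<in> leaves r t" for x
  proof (cases x)
    case (Cyc i)
    then show ?thesis using x by (auto simp: leaves_def pendants_def arms_def)
  next
    case (Pend i j)
    then have "i < 3" "j < r" using x by (auto simp: leaves_def pendants_def arms_def)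
    then show ?thesis using Pend by (simp add: vertex_sum_leaf)
  next
    case (Arm c k)
    then have "c < t" "k = 0 \<or> k = 1" using x by (auto simp: leaves_def pendants_def arms_def)
    then show ?thesis using Arm vertex_sum_path(1,3)[of c t r f] by auto
  qed
  have inj_leaf: "inj_on leaf_of (leaves r t)"
    by (auto simp: inj_on_def leaves_def pendants_def arms_def)
  have L: "inj_on ?S ?L \<longleftrightarrow> inj_on ?g (leaves r t)" "?S ` ?L = ?g ` leaves r t"
    by (rule reparametrize[OF inj_leaf], erule leaf)+
  have "leaf_of x \<noteq> Inl (Inl i)" "leaf_of x \<noteq> Inr (c, 1)" if "x \<in> leaves r t" for x i c
    using that by (cases x; force simp: leaves_def pendants_def arms_def)+
  then have "?H \<inter> ?K = {}" "(?H \<union> ?K) \<inter> ?L = {}"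
    by (blast, fastforce)
  then have disj: "?H - ?K = ?H" "?K - ?H = ?K" "(?H \<union> ?K) - ?L = ?H \<union> ?K" "?L - (?H \<union> ?K) = ?L"
    by blast+
  have "inj_on ?S (verts ?G) \<longleftrightarrow>
     inj_on (hub_sum r ?g) {..<3} \<and> inj_on (centre_sum ?g) {..<t} \<and> inj_on ?g (leaves r t) \<and>
     hub_sum r ?g ` {..<3} \<inter> centre_sum ?g ` {..<t} = {} \<and>
     (hub_sum r ?g ` {..<3} \<union> centre_sum ?g ` {..<t}) \<inter> ?g ` leaves r t = {}"
    unfolding verts_by_kind inj_on_Un disj image_Un H K L by (simp only: conj_ac)
  moreover have "inj_on ?g (leaves r t)" if "bij_betw ?g (names r t) {1..3 * r + 3 + 2 * t}"
    using inj_on_subset[OF bij_betw_imp_inj_on[OF that] leaves_subset_names] .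
  moreover have "(\<forall>u\<in>verts ?G. \<forall>v\<in>verts ?G. u \<noteq> v \<longrightarrow> ?S u \<noteq> ?S v) \<longleftrightarrow> inj_on ?S (verts ?G)"
    by (auto simp: inj_on_def)
  ultimately show ?thesis
    unfolding antimagic_labeling_def antimagic_naming_def bij by argo
qed

lemma antimagic_jellyfish_paths_iff:
  "antimagic (jellyfish_paths r t) \<longleftrightarrow> (\<exists>g. antimagic_naming r t g)"
proof -
  have "(g \<circ> inv edge_of) \<circ> edge_of = g" for g :: "edge_name \<Rightarrow> nat"
    by (simp add: comp_assoc inv_o_cancel[OF inj_edge_of])
  then show ?thesis
    unfolding antimagic_def antimagic_labeling_iff by metis
qed

section \<open>Too many paths\<close>

text \<open>
  The extremal sets are \<open>{M + 1..M + n}\<close> here and \<open>{M - n + 1..M}\<close> in the next lemma.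
\<close>

lemma sum_nat_lower_bound:
  fixes A :: "nat set"
  assumes "finite A" "\<And>x. x \<in> A \<Longrightarrow> M < x"
  shows "card A * (2 * M + card A + 1) \<le> 2 * \<Sum>A"
  using assms
proof (induction A rule: finite_linorder_max_induct)
  case (insert b A)
  have "A \<subseteq> {M<..<b}" using insert by auto
  then have "card A \<le> card {M<..<b}" by (rule card_mono[rotated]) simp
  moreover have "M < b" using insert by simp
  ultimately have "M + card A + 1 \<le> b" by simp
  moreover have "b \<notin> A" using insert.hyps by auto
  ultimately show ?case using insert by (simp add: algebra_simps)
qed simp

lemma sum_nat_upper_bound:
  fixes A :: "nat set"
  assumes "finite A" "\<And>x. x \<in> A \<Longrightarrow> x \<le> M"
  shows "2 * \<Sum>A + card A * card A \<le> card A * (2 * M + 1)"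
  using assms
proof (induction A rule: finite_linorder_min_induct)
  case (insert b A)
  have "A \<subseteq> {b<..M}" using insert by auto
  then have "card A \<le> card {b<..M}" by (rule card_mono[rotated]) simp
  moreover have "b \<le> M" using insert by simp
  ultimately have "card A + b \<le> M" by simp
  moreover have "b \<notin> A" using insert.hyps by auto
  ultimately show ?case using insert by (simp add: algebra_simps)
qed simp

text \<open>
  \<open>B\<close> collects the centres with sums beyond all labels. The sums in \<open>S\<close> are labels, but not labels
  of edges at a leaf, so they are triangle labels and there are at most three of them. Counting the
  total label on the arms of \<open>B\<close> in two ways bounds \<open>card B\<close>.
\<close>

lemma antimagic_naming_bound:
  assumes "antimagic_naming r t g"
  shows "t \<le> 6 * r + 22"
proof -
  define M where "M = 3 * r + 3 + 2 * t"
  define B where "B = {c \<in> {..<t}. M < centre_sum g c}"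
  define S where "S = {c \<in> {..<t}. centre_sum g c \<le> M}"
  have inj: "inj_on g (names r t)" and img: "g ` names r t = {1..M}"
    using assms by (auto simp: antimagic_naming_def bij_betw_def M_def)
  have inj_centre: "inj_on (centre_sum g) {..<t}"
    using assms by (simp add: antimagic_naming_def)
  have inj_S: "inj_on (centre_sum g) S" and inj_B: "inj_on (centre_sum g) B"
    by (rule inj_on_subset[OF inj_centre]; auto simp: S_def B_def)+
  have "centre_sum g ` S \<subseteq> g ` Cyc ` {..<3}"
  proof clarify
    fix c assume c: "c \<in> S"
    then have "Arm c 0 \<in> names r t"
      by (auto simp: S_def names_def arms_def)
    then have "g (Arm c 0) \<in> {1..M}" using img by blast
    then have "centre_sum g c \<in> g ` names r t"
      using c unfolding img by (simp add: S_def centre_sum_def)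
    moreover have "centre_sum g c \<notin> g ` leaves r t"
      using assms c by (auto simp: antimagic_naming_def S_def)
    ultimately show "centre_sum g c \<in> g ` Cyc ` {..<3}"
      by (auto simp: names_def leaves_def)
  qed
  then have "card (centre_sum g ` S) \<le> card (g ` Cyc ` {..<3})"
    by (rule card_mono[rotated]) simp
  also have "\<dots> \<le> card {..<3::nat}"
    by (rule order_trans[OF card_image_le card_image_le]) simp_all
  finally have "card S \<le> 3"
    by (simp add: card_image[OF inj_S])
  moreover have "t = card B + card S"
  proof -
    have "{..<t} = B \<union> S" by (auto simp: B_def S_def)
    moreover have "card (B \<union> S) = card B + card S"
      by (rule card_Un_disjoint) (auto simp: B_def S_def)
    ultimately show ?thesis by (metis card_lessThan)
  qed
  moreover have "5 * card B \<le> 2 * M + 1"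
  proof -
    have arms: "arms B \<subseteq> names r t" by (auto simp: B_def names_def arms_def)
    have injA: "inj_on g (arms B)" using inj arms by (rule inj_on_subset)
    have "finite B" by (simp add: B_def)
    have "inj_on (case_prod Arm) (B \<times> {..<2})" by (auto simp: inj_on_def)
    then have "sum g (arms B) = (\<Sum>c\<in>B. \<Sum>k<2. g (Arm c k))"
      by (simp add: arms_def sum.reindex sum.cartesian_product case_prod_beta' comp_def)
    then have "\<Sum>(g ` arms B) = sum (centre_sum g) B"
      by (simp add: sum.reindex[OF injA] centre_sum_def numeral_2_eq_2)
    also have "\<dots> = \<Sum>(centre_sum g ` B)"
      by (simp add: sum.reindex[OF inj_B])
    finally have eq: "\<Sum>(g ` arms B) = \<Sum>(centre_sum g ` B)" .
    have "card (centre_sum g ` B) = card B"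
      by (rule card_image[OF inj_B])
    moreover have "card (centre_sum g ` B) * (2 * M + card (centre_sum g ` B) + 1)
        \<le> 2 * \<Sum>(centre_sum g ` B)"
      by (rule sum_nat_lower_bound) (auto simp: B_def)
    moreover have "2 * \<Sum>(g ` arms B) + card (g ` arms B) * card (g ` arms B)
        \<le> card (g ` arms B) * (2 * M + 1)"
    proof (rule sum_nat_upper_bound)
      show "finite (g ` arms B)" using \<open>finite B\<close> by (simp add: finite_arms)
      show "x \<le> M" if "x \<in> g ` arms B" for x
      proof -
        have "x \<in> g ` names r t" using that arms by blast
        then show ?thesis unfolding img by simp
      qed
    qed
    moreover have "card (g ` arms B) = 2 * card B"
      by (simp add: card_image[OF injA] card_arms)
    ultimately have "card B * (5 * card B) \<le> card B * (2 * M + 1)"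
      unfolding eq by (simp add: algebra_simps)
    then show ?thesis by (simp only: mult_le_cancel1) auto
  qed
  ultimately show ?thesis by (simp add: M_def)
qed

section \<open>Pairing an interval of labels with nearly equal sums\<close>

text \<open>
  For every \<open>n\<close>, \<open>partner n\<close> permutes \<open>{1..n}\<close> (shifted by one in the argument) such that the sums
  \<open>k + partner n k\<close> are distinct and lie in an interval of at most \<open>n + 1\<close> numbers: even \<open>k\<close> yield
  the first half of the interval in increasing order and odd \<open>k\<close> the second half. For odd \<open>n\<close> the
  interval is filled; for even \<open>n\<close> its middle element \<open>n\<close> is left out.
\<close>

definition partner :: "nat \<Rightarrow> nat \<Rightarrow> nat" where
  "partner n k = (if even k then (n + 1) div 2 else n) - k div 2"

lemma partner_range: "k < n \<Longrightarrow> partner n k \<in> {1..n}"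
  unfolding partner_def by auto

lemma add_partner_even: "k < n \<Longrightarrow> even k \<Longrightarrow> k + partner n k = (n + 1) div 2 + k div 2"
  unfolding partner_def by (auto elim!: evenE)
lemma add_partner_odd: "k < n \<Longrightarrow> odd k \<Longrightarrow> k + partner n k = n + 1 + k div 2"
  unfolding partner_def by (auto elim!: oddE)

lemma inj_on_partner: "inj_on (partner n) {..<n}"
proof (rule inj_onI)
  fix k k' assume "k \<in> {..<n}" "k' \<in> {..<n}" "partner n k = partner n k'"
  then show "k = k'" 
  by (cases "even k"; cases "even k'") (auto simp: partner_def elim!: evenE oddE)
qed

lemma add_partner_range: "k < n \<Longrightarrow> k + partner n k \<in> {(n + 1) div 2..n + n div 2}"
  by (cases "even k") (auto simp: add_partner_even add_partner_odd elim!: evenE oddE)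

lemma inj_on_add_partner: "inj_on (\<lambda>k. k + partner n k) {..<n}"
proof (rule inj_onI)
  fix k k' assume "k \<in> {..<n}" "k' \<in> {..<n}" "k + partner n k = k' + partner n k'"
  then show "k = k'" 
  by (cases "even k"; cases "even k'") (auto simp: add_partner_even add_partner_odd elim!: evenE oddE)
qed

section \<open>Extending a labeling of the core\<close>

lemma inj_on_UnI: "inj_on f A \<Longrightarrow> inj_on f B \<Longrightarrow> f ` A \<inter> f ` B = {} \<Longrightarrow> inj_on f (A \<union> B)"
  unfolding inj_on_Un by blast

text \<open>
  The core consists of the jellyfish and the first \<open>s\<close> paths, labeled \<open>1, \<dots>, L\<close>, with the sums of
  these \<open>s\<close> paths hidden among the triangle labels. The \<open>n\<close> additional paths get the pairs
  \<open>L + 1 + k\<close> and \<open>L + n + partner n k\<close>. Their sums lie above the largest label \<open>L + 2 * n\<close> because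
  \<open>n \<le> 2 * L + 1\<close>, and below the hub sums by assumption.
\<close>

lemma antimagic_naming_extend:
  assumes L: "L = 3 * r + 3 + 2 * s" and n: "n \<le> 2 * L + 1"
    and bij: "bij_betw g (names r s) {1..L}"
    and centre: "inj_on (centre_sum g) {..<s}" "centre_sum g ` {..<s} \<subseteq> g ` Cyc ` {..<3}"
    and hub: "inj_on (hub_sum r g) {..<3}" 
    and hub_gt: "\<And>i. i < 3 \<Longrightarrow> 2 * L + 2 * n + 1 + n div 2 < hub_sum r g i"
  shows "\<exists>g'. antimagic_naming r (s + n) g'"
proof
  define new where "new c k = (if k = 0 then L + 1 + (c - s) else L + n + partner n (c - s))" for c k :: nat
  define g' where "g' x = (case x of Arm c k \<Rightarrow> if c < s then g x else new c k | _ \<Rightarrow> g x)" for x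
  have split_c: "{..<s + n} = {..<s} \<union> {s..<s + n}" by auto
  have split: "names r (s + n) = names r s \<union> arms {s..<s + n}"
    by (simp add: names_def split_c arms_Un Un_assoc)
  have old: "g' x = g x" if "x \<in> names r s" for x
    using that by (auto simp: g'_def names_def pendants_def arms_def)
  have new: "g' (Arm c k) = new c k" if "c \<ge> s" for c k
    using that by (simp add: g'_def)
  have old_img: "g' ` names r s = {1..L}"
    using bij old by (auto simp: bij_betw_def)
  have new_range: "new c k \<in> {L + 1..L + 2 * n}" if "s \<le> c" "c < s + n" for c k
    using that partner_range[of "c - s" n] by (auto simp: new_def)
  have inj_new: "c = c' \<and> k = k'"
    if "new c k = new c' k'" "s \<le> c" "c < s + n" "s \<le> c'" "c' < s + n" "k < 2" "k' < 2" for c c' k k'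
  proof -
    have "c - s = c' - s" if "partner n (c - s) = partner n (c' - s)"
      using inj_onD[OF inj_on_partner that] \<open>s \<le> c\<close> \<open>c < s + n\<close> \<open>s \<le> c'\<close> \<open>c' < s + n\<close> by simp
    moreover have "1 \<le> partner n (c - s)" "1 \<le> partner n (c' - s)"
      using partner_range[of "c - s" n] partner_range[of "c' - s" n] that by auto
    ultimately show ?thesis
      using that by (auto simp: new_def split: if_splits)
  qed
  have new_img: "g' ` arms {s..<s + n} \<subseteq> {L + 1..L + 2 * n}"
    using new_range new by (auto simp: arms_def simp del: atLeastAtMost_iff)
  have "inj_on g' (names r s)"
    using bij old by (simp add: bij_betw_def inj_on_def)
  moreover have "inj_on g' (arms {s..<s + n})"
  proof (rule inj_onI)
    fix x y assume x: "x \<in> arms {s..<s + n}" and y: "y \<in> arms {s..<s + n}" and eq: "g' x = g' y"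
    obtain c k where ck: "x = Arm c k" "s \<le> c" "c < s + n" "k < 2"
      using x by (auto simp: arms_def)
    obtain c' k' where ck': "y = Arm c' k'" "s \<le> c'" "c' < s + n" "k' < 2"
      using y by (auto simp: arms_def)
    have "new c k = new c' k'" using eq ck ck' by (simp add: new)
    then show "x = y" using inj_new[of c k c' k'] ck ck' by simp
  qed
  moreover have "g' ` names r s \<inter> g' ` arms {s..<s + n} = {}"
    using new_img unfolding old_img by fastforce
  ultimately have inj: "inj_on g' (names r (s + n))"
    unfolding split by (rule inj_on_UnI)
  have img: "g' ` names r (s + n) = {1..3 * r + 3 + 2 * (s + n)}"
  proof (rule card_subset_eq)
    show "g' ` names r (s + n) \<subseteq> {1..3 * r + 3 + 2 * (s + n)}"
      using new_img unfolding split image_Un old_img L by fastforce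
    show "card (g' ` names r (s + n)) = card {1..3 * r + 3 + 2 * (s + n)}"
      by (simp add: card_image[OF inj] card_names)
  qed simp
  have hub': "hub_sum r g' i = hub_sum r g i" for i
    by (simp add: hub_sum_def g'_def)
  have centre_old: "centre_sum g' c = centre_sum g c" if "c < s" for c
    using that by (simp add: centre_sum_def g'_def)
  have centre_new: "centre_sum g' c = 2 * L + n + 1 + ((c - s) + partner n (c - s))" if "s \<le> c" for c
    using that by (simp add: centre_sum_def new new_def)
  have centre_new_range: "centre_sum g' c \<in> {L + 2 * n + 1..2 * L + 2 * n + 1 + n div 2}"
    if "s \<le> c" "c < s + n" for c
  proof -
    have "c - s < n" using that by simp
    then have "(n + 1) div 2 \<le> (c - s) + partner n (c - s)" "(c - s) + partner n (c - s) \<le> n + n div 2"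
      using add_partner_range by (auto simp del: add_diff_assoc2)
    moreover have "n \<le> L + (n + 1) div 2" using n by linarith
    ultimately show ?thesis
      unfolding centre_new[OF that(1)] atLeastAtMost_iff by linarith
  qed
  have centre_old_le: "centre_sum g c \<le> L" if "c < s" for c
  proof -
    have "centre_sum g c \<in> g ` names r s" using that centre(2) by (auto simp: names_def)
    then show ?thesis using bij by (simp add: bij_betw_def)
  qed
  have leaf_le: "g' x \<le> L + 2 * n" if "x \<in> leaves r (s + n)" for x
  proof -
    have "g' x \<in> g' ` names r (s + n)" using that leaves_subset_names by blast
    then show ?thesis unfolding img L by simp
  qed
  have hub_gt': "L + 2 * n < hub_sum r g i" if "i < 3" for i
    using hub_gt[OF that] by simp
  have inj_centre: "inj_on (centre_sum g') {..<s + n}"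
  proof -
    have old_inj: "inj_on (centre_sum g') {..<s}"
      using centre(1) by (simp add: inj_on_def centre_old)
    have new_inj: "inj_on (centre_sum g') {s..<s + n}"
    proof (rule inj_onI)
      fix c c' assume *: "c \<in> {s..<s + n}" "c' \<in> {s..<s + n}" "centre_sum g' c = centre_sum g' c'"
      then have "(c - s) + partner n (c - s) = (c' - s) + partner n (c' - s)"
        using centre_new[of c] centre_new[of c'] unfolding atLeastLessThan_iff by linarith
      moreover have "c - s \<in> {..<n}" "c' - s \<in> {..<n}" using * by auto
      ultimately have "c - s = c' - s"
        using inj_onD[OF inj_on_add_partner, of "c - s" n "c' - s"] by blast
      then show "c = c'" using * by auto
    qed
    have "centre_sum g' c \<noteq> centre_sum g' c'" if "c < s" "s \<le> c'" "c' < s + n" for c c'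
      using centre_old_le[of c] centre_new_range[of c'] that by (simp add: centre_old)
    then have "centre_sum g' ` {..<s} \<inter> centre_sum g' ` {s..<s + n} = {}"
      by force
    with old_inj new_inj show ?thesis
      unfolding split_c by (rule inj_on_UnI)
  qed
  have "hub_sum r g i \<noteq> centre_sum g' c" if "i < 3" "c < s + n" for i c
    using that hub_gt[of i] centre_new_range[of c] centre_old_le[of c] centre_old[of c]
    by (cases "c < s") auto
  then have hub_centre: "hub_sum r g' ` {..<3} \<inter> centre_sum g' ` {..<s + n} = {}"
    by (auto simp: hub')
  have "hub_sum r g i \<noteq> g' x" if "i < 3" "x \<in> leaves r (s + n)" for i x
    using that leaf_le[of x] hub_gt'[of i] by auto
  moreover have "centre_sum g' c \<noteq> g' x" if c: "c < s + n" and x: "x \<in> leaves r (s + n)" for c x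
  proof (cases "c < s")
    case True
    then obtain i where i: "i < 3" "centre_sum g' c = g' (Cyc i)"
      using centre(2) by (auto simp: centre_old g'_def)
    have "Cyc i \<in> names r (s + n)" "Cyc i \<noteq> x" "x \<in> names r (s + n)"
      using i x leaves_subset_names by (auto simp: names_def leaves_def pendants_def arms_def)
    then show ?thesis
      using inj i by (auto dest: inj_onD)
  next
    case False
    then show ?thesis using leaf_le[OF x] centre_new_range[of c] c by auto
  qed
  ultimately have "(hub_sum r g' ` {..<3} \<union> centre_sum g' ` {..<s + n}) \<inter> g' ` leaves r (s + n) = {}"
    by (auto simp: hub') metis+
  then show "antimagic_naming r (s + n) g'"
    unfolding antimagic_naming_def bij_betw_def
    using inj img hub inj_centre hub_centre by (simp add: inj_on_def hub')
qed

section \<open>At most two paths\<close>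

text \<open>
  The pendant labels are dealt out in turn to the three hubs, so that the sums of pendant labels at
  consecutive hubs differ by \<open>r\<close>, far more than the triangle labels can compensate.
\<close>

definition sequential_core :: "nat \<Rightarrow> edge_name \<Rightarrow> nat" where
  "sequential_core r x = (case x of Cyc i \<Rightarrow> 3 * r + 1 + i | Pend i j \<Rightarrow> 3 * j + i + 1 | Arm c k \<Rightarrow> 0)"

lemma bij_betw_namesI:
  assumes "inj_on g (names r s)" "g ` names r s \<subseteq> {1..L}" "L = 3 * r + 3 + 2 * s"
  shows "bij_betw g (names r s) {1..L}"
proof -
  have "g ` names r s = {1..L}"
    by (rule card_subset_eq) (use assms in \<open>simp_all add: card_image card_names\<close>)
  then show ?thesis using assms(1) by (simp add: bij_betw_def)
qed

lemma names_cases: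
  assumes "x \<in> names r s"
  obtains i where "x = Cyc i" "i < 3"
  | i j where "x = Pend i j" "i < 3" "j < r"
  | c k where "x = Arm c k" "c < s" "k < 2"
  using assms by (auto simp: names_def pendants_def arms_def)

lemma bij_sequential_core: "bij_betw (sequential_core r) (names r 0) {1..3 * r + 3}"
proof (rule bij_betw_namesI)
  have base3: "i = i' \<and> j = j'" if "3 * j + i = 3 * j' + i'" "i < 3" "i' < 3" for i i' j j' :: nat
    using that by presburger
  show "inj_on (sequential_core r) (names r 0)"
  proof (rule inj_onI)
    fix x y assume "x \<in> names r 0" "y \<in> names r 0" "sequential_core r x = sequential_core r y"
    then show "x = y"
      by (elim names_cases) (auto simp: sequential_core_def dest: base3)
  qed
  show "sequential_core r ` names r 0 \<subseteq> {1..3 * r + 3}"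
    by (auto simp: sequential_core_def elim!: names_cases)
qed simp

lemma sum_sequential_core: "2 * (\<Sum>j<r. sequential_core r (Pend i j)) + 3 * r = 3 * r * r + 2 * r * (i + 1)"
proof -
  have "2 * (\<Sum>j<n. 3 * j + i + 1) + 3 * n = 3 * n * n + 2 * n * (i + 1)" for n :: nat
    by (induction n) (simp_all add: algebra_simps)
  then show ?thesis by (simp add: sequential_core_def)
qed

lemma antimagic_naming_few_paths:
  assumes "r \<ge> 11" "t \<le> 2"
  shows "\<exists>g. antimagic_naming r t g"
proof -
  define L where "L = 3 * r + 3"
  define q where "q = r * r"
  have S: "2 * (\<Sum>j<r. sequential_core r (Pend i j)) + 3 * r = 3 * q + 2 * r * (i + 1)" for i
    unfolding sum_sequential_core q_def by (simp only: mult.assoc)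
  have hub0: "hub_sum r (sequential_core r) 0 = 6 * r + 4 + (\<Sum>j<r. sequential_core r (Pend 0 j))"
    and hub1: "hub_sum r (sequential_core r) 1 = 6 * r + 3 + (\<Sum>j<r. sequential_core r (Pend 1 j))"
    and hub2: "hub_sum r (sequential_core r) 2 = 6 * r + 5 + (\<Sum>j<r. sequential_core r (Pend 2 j))"
    by (simp_all add: hub_sum_def sequential_core_def)
  have rr: "11 * r \<le> q" using assms(1) by (simp add: q_def)
  have lt: "2 * L + 2 * t + 1 + t div 2 < hub_sum r (sequential_core r) 0"
    "hub_sum r (sequential_core r) 0 < hub_sum r (sequential_core r) 1"
    "hub_sum r (sequential_core r) 1 < hub_sum r (sequential_core r) 2"
    using S[of 0] S[of 1] S[of 2] rr assms unfolding hub0 hub1 hub2 L_def by simp_all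
  have "\<exists>g. antimagic_naming r (0 + t) g"
  proof (rule antimagic_naming_extend)
    show "L = 3 * r + 3 + 2 * 0" by (simp add: L_def)
    show "t \<le> 2 * L + 1" using assms by (simp add: L_def)
    show "bij_betw (sequential_core r) (names r 0) {1..L}"
      unfolding L_def by (rule bij_sequential_core)
    show "inj_on (hub_sum r (sequential_core r)) {..<3}"
      using lt unfolding lessThan_3 by (auto simp: inj_on_def)
    show "2 * L + 2 * t + 1 + t div 2 < hub_sum r (sequential_core r) i" if "i < 3" for i
    proof -
      have "i = 0 \<or> i = 1 \<or> i = 2" using that by linarith
      then show ?thesis using lt by auto
    qed
  qed simp_all
  then show ?thesis by simp
qed

section \<open>Three or more paths\<close>

text \<open>
  The numbers from \<open>10\<close> on are dealt out to the hubs in rows of three, and every other row in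
  the opposite order, so that the totals of the hubs differ by at most two.
\<close>

definition row :: "nat \<Rightarrow> nat \<Rightarrow> nat" where
  "row i j = 3 * j + 10 + (if even j then i else 2 - i)"

text \<open>
  The small numbers are used up by \<open>6 = 1 + 5\<close>, \<open>7 = 3 + 4\<close> and \<open>10 = 2 + 8\<close>: the left-hand sides
  are the triangle labels, the right-hand sides the labels of the first three paths. A decomposition
  of \<open>{1..9}\<close> into three such equations is impossible, because the sum \<open>45\<close> is odd; hence \<open>10\<close>
  takes the place of \<open>9\<close>, and \<open>9\<close> replaces \<open>10\<close> as the first entry of the first row.
  The triangle labels contribute \<open>16\<close>, \<open>13\<close> and \<open>17\<close> to the three hub sums, which makes
  the hub sums distinct for both parities of \<open>r\<close>.
\<close>

definition balanced_core :: "edge_name \<Rightarrow> nat" where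
  "balanced_core x = (case x of
     Cyc i \<Rightarrow> [6, 7, 10] ! i
   | Pend i j \<Rightarrow> if i = 0 \<and> j = 0 then 9 else row i j
   | Arm c k \<Rightarrow> [[1, 5], [3, 4], [2, 8]] ! c ! k)"

lemma row_inj: "row i j = row i' j' \<Longrightarrow> i < 3 \<Longrightarrow> i' < 3 \<Longrightarrow> i = i' \<and> j = j'"
proof -
  assume *: "row i j = row i' j'" "i < 3" "i' < 3"
  then have "j = j'" by (auto simp: row_def split: if_splits)
  with * show ?thesis by (auto simp: row_def split: if_splits)
qed

lemma row_ge: "i < 3 \<Longrightarrow> \<not> (i = 0 \<and> j = 0) \<Longrightarrow> 11 \<le> row i j"
  by (cases j) (auto simp: row_def)

lemma bij_balanced_core:
  assumes "r \<ge> 11"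
  shows "bij_betw balanced_core (names r 3) {1..3 * r + 9}"
proof (rule bij_betw_namesI)
  have cyc: "balanced_core (Cyc i) \<in> {6, 7, 10}" if "i < 3" for i
    using that by (auto simp: balanced_core_def numeral_3_eq_3 less_Suc_eq)
  have arm: "balanced_core (Arm c k) \<in> {1, 2, 3, 4, 5, 8}" if "c < 3" "k < 2" for c k
    using that by (auto simp: balanced_core_def numeral_3_eq_3 numeral_2_eq_2 less_Suc_eq)
  have pend: "balanced_core (Pend i j) \<in> insert 9 {11..3 * r + 9}" if "i < 3" "j < r" for i j
    using that row_ge[of i j] by (auto simp: balanced_core_def row_def)
  have inj_cyc: "i = i'" if "balanced_core (Cyc i) = balanced_core (Cyc i')" "i < 3" "i' < 3" for i i'
    using that by (auto simp: balanced_core_def numeral_3_eq_3 less_Suc_eq)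
  have inj_arm: "c = c' \<and> k = k'"
    if "balanced_core (Arm c k) = balanced_core (Arm c' k')" "c < 3" "c' < 3" "k < 2" "k' < 2" for c c' k k'
    using that by (auto simp: balanced_core_def numeral_3_eq_3 numeral_2_eq_2 less_Suc_eq)
  have inj_pend: "i = i' \<and> j = j'"
    if "balanced_core (Pend i j) = balanced_core (Pend i' j')" "i < 3" "i' < 3" for i i' j j'
    using that row_inj[of i j i' j'] row_ge[of i j] row_ge[of i' j']
    by (simp add: balanced_core_def split: if_splits)
  show "inj_on balanced_core (names r 3)"
  proof (rule inj_onI)
    fix x y assume x: "x \<in> names r 3" and y: "y \<in> names r 3" and eq: "balanced_core x = balanced_core y"
    show "x = y"
    proof (rule names_cases[OF x]; rule names_cases[OF y])
      fix i i' assume "x = Cyc i" "y = Cyc i'" "i < 3" "i' < 3"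
      then show ?thesis using eq inj_cyc by blast
    next
      fix i i' j' assume "x = Cyc i" "y = Pend i' j'" "i < 3" "i' < 3" "j' < r"
      then show ?thesis using eq cyc[of i] pend[of i' j'] by auto
    next
      fix i c k assume "x = Cyc i" "y = Arm c k" "i < 3" "c < 3" "k < 2"
      then show ?thesis using eq cyc[of i] arm[of c k] by auto
    next
      fix i j i' assume "x = Pend i j" "y = Cyc i'" "i < 3" "j < r" "i' < 3"
      then show ?thesis using eq cyc[of i'] pend[of i j] by auto
    next
      fix i j i' j' assume "x = Pend i j" "y = Pend i' j'" "i < 3" "i' < 3"
      then show ?thesis using eq inj_pend by blast
    next
      fix i j c k assume "x = Pend i j" "y = Arm c k" "i < 3" "j < r" "c < 3" "k < 2"
      then show ?thesis using eq arm[of c k] pend[of i j] by auto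
    next
      fix i c k assume "x = Arm c k" "y = Cyc i" "i < 3" "c < 3" "k < 2"
      then show ?thesis using eq cyc[of i] arm[of c k] by auto
    next
      fix i j c k assume "x = Arm c k" "y = Pend i j" "i < 3" "j < r" "c < 3" "k < 2"
      then show ?thesis using eq arm[of c k] pend[of i j] by auto
    next
      fix c k c' k' assume "x = Arm c k" "y = Arm c' k'" "c < 3" "c' < 3" "k < 2" "k' < 2"
      then show ?thesis using eq inj_arm by blast
    qed
  qed
  show "balanced_core ` names r 3 \<subseteq> {1..3 * r + 9}"
  proof clarify
    fix x assume "x \<in> names r 3"
    then show "balanced_core x \<in> {1..3 * r + 9}"
    proof (cases rule: names_cases)
      case (1 i)
      then show ?thesis using cyc[of i] assms by auto
    next
      case (2 i j)
      then show ?thesis using pend[of i j] assms by auto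
    next
      case (3 c k)
      then show ?thesis using arm[of c k] assms by auto
    qed
  qed
qed simp

lemma sum_row:
  shows "2 * (\<Sum>j<r. row 1 j) = 3 * r * r + 19 * r"
    and "(\<Sum>j<r. row 0 j) + r mod 2 = (\<Sum>j<r. row 1 j)"
    and "(\<Sum>j<r. row 2 j) = (\<Sum>j<r. row 1 j) + r mod 2"
proof -
  show "2 * (\<Sum>j<r. row 1 j) = 3 * r * r + 19 * r"
    by (induction r) (simp_all add: row_def algebra_simps)
  have "(\<Sum>j<r. row 0 j) + r mod 2 = (\<Sum>j<r. row 1 j) \<and> (\<Sum>j<r. row 2 j) = (\<Sum>j<r. row 1 j) + r mod 2"
  proof (induction r)
    case (Suc r)
    then show ?case by (cases "even r") (auto simp: row_def elim!: evenE oddE)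
  qed simp
  then show "(\<Sum>j<r. row 0 j) + r mod 2 = (\<Sum>j<r. row 1 j)"
    "(\<Sum>j<r. row 2 j) = (\<Sum>j<r. row 1 j) + r mod 2" by auto
qed

text \<open>
  For \<open>r = 11\<close> and \<open>t = 6 * r + 22\<close> the hub sums are \<open>300\<close>, \<open>299\<close> and \<open>304\<close>, just above the
  largest centre sum \<open>297\<close>.
\<close>

lemma antimagic_naming_many_paths:
  assumes "r \<ge> 11" "3 \<le> t" "t \<le> 6 * r + 22"
  shows "\<exists>g. antimagic_naming r t g"
proof -
  let ?g = balanced_core
  define L where "L = 3 * r + 9"
  define n where "n = t - 3"
  define A where "A = (\<Sum>j<r. row 1 j)"
  define q where "q = r * r"
  have A: "2 * A = 3 * q + 19 * r" unfolding A_def q_def sum_row(1) by (simp only: mult.assoc)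
  \<comment> \<open>one less than in the rows, because of the label \<open>9\<close> in the place of \<open>10\<close>\<close>
  have pend0: "(\<Sum>j<r. ?g (Pend 0 j)) + 1 = (\<Sum>j<r. row 0 j)"
  proof -
    have "(\<Sum>j<Suc m. ?g (Pend 0 j)) + 1 = (\<Sum>j<Suc m. row 0 j)" for m
      by (induction m) (simp_all add: balanced_core_def row_def)
    from this[of "r - 1"] show ?thesis using assms(1) by simp
  qed
  have hub0: "hub_sum r ?g 0 + r mod 2 = A + 15"
    using pend0 sum_row(2)[of r] by (simp add: hub_sum_def balanced_core_def A_def)
  have hub1: "hub_sum r ?g 1 = A + 13"
    by (simp add: hub_sum_def balanced_core_def A_def)
  have hub2: "hub_sum r ?g 2 = A + 17 + r mod 2"
    using sum_row(3)[of r] by (simp add: hub_sum_def balanced_core_def A_def)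
  have r2: "r mod 2 \<le> 1" by linarith
  have n: "n \<le> 2 * L + 1" using assms by (simp add: n_def L_def)
  have "11 * r \<le> q" using assms(1) by (simp add: q_def)
  then have "26 * r \<le> A" using A by linarith
  then have "7 * L + 3 < A + 13" using assms(1) unfolding L_def by simp
  then have gt: "2 * L + 2 * n + 1 + n div 2 < A + 13" using n by linarith
  have "\<exists>g. antimagic_naming r (3 + n) g"
  proof (rule antimagic_naming_extend)
    show "L = 3 * r + 3 + 2 * 3" by (simp add: L_def)
    show "n \<le> 2 * L + 1" by (rule n)
    show "bij_betw ?g (names r 3) {1..L}"
      unfolding L_def using assms(1) by (rule bij_balanced_core)
    show "inj_on (centre_sum ?g) {..<3}" "centre_sum ?g ` {..<3} \<subseteq> ?g ` Cyc ` {..<3}"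
      unfolding lessThan_3 by (simp_all add: centre_sum_def balanced_core_def inj_on_def)
    have "hub_sum r ?g 1 < hub_sum r ?g 0" "hub_sum r ?g 0 < hub_sum r ?g 2"
      using hub0 hub1 hub2 r2 by linarith+
    then show "inj_on (hub_sum r ?g) {..<3}"
      unfolding lessThan_3 by (auto simp: inj_on_def)
    show "2 * L + 2 * n + 1 + n div 2 < hub_sum r ?g i" if "i < 3" for i
    proof -
      have "i = 0 \<or> i = 1 \<or> i = 2" using that by linarith
      then show ?thesis using gt hub0 hub1 hub2 r2 by (elim disjE) simp_all
    qed
  qed
  then show ?thesis using assms(2) by (simp add: n_def)
qed

lemma antimagic_jellyfish_paths:
  assumes "r \<ge> 11"
  shows "antimagic (jellyfish_paths r t) \<longleftrightarrow> t \<le> 6 * r + 22"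
proof
  show "t \<le> 6 * r + 22" if "antimagic (jellyfish_paths r t)"
    using that antimagic_naming_bound unfolding antimagic_jellyfish_paths_iff by blast
  show "antimagic (jellyfish_paths r t)" if "t \<le> 6 * r + 22"
    using antimagic_naming_few_paths[OF assms] antimagic_naming_many_paths[OF assms _ that]
    unfolding antimagic_jellyfish_paths_iff by (cases "t \<le> 2") auto
qed

section \<open>The parameters tau and beta of the jellyfish\<close>

lemma antimagic_disjoint_union_no_copies:
  assumes "antimagic (disjoint_union G (copies 0 H))"
  shows "antimagic G"
proof -
  let ?D = "disjoint_union G (copies 0 H)"
  obtain f where f: "antimagic_labeling ?D f"
    using assms by (auto simp: antimagic_def)
  let ?h = "\<lambda>e. Inl ` e"
  have E: "edges ?D = ?h ` edges G"
    by (simp add: disjoint_union_def copies_def)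
  have inj: "inj_on ?h A" for A :: "'a set set"
    by (simp add: inj_on_def inj_image_eq_iff)
  have "bij_betw (f \<circ> ?h) (edges G) {1..card (edges G)}"
  proof (rule bij_betw_trans)
    show "bij_betw ?h (edges G) (edges ?D)" by (simp add: bij_betw_def inj E)
    show "bij_betw f (edges ?D) {1..card (edges G)}"
      using f by (simp add: antimagic_labeling_def E card_image[OF inj])
  qed
  moreover have "vertex_sum G (f \<circ> ?h) v = vertex_sum ?D f (Inl v)" for v
  proof -
    have "{e. e \<in> edges ?D \<and> Inl v \<in> e} = ?h ` {e. e \<in> edges G \<and> v \<in> e}"
      unfolding E by auto
    then show ?thesis by (simp add: vertex_sum_def sum.reindex[OF inj])
  qed
  moreover have "Inl v \<in> verts ?D" if "v \<in> verts G" for v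
    using that by (auto simp: disjoint_union_def)
  ultimately have "antimagic_labeling G (f \<circ> ?h)"
    using f unfolding antimagic_labeling_def by auto
  then show ?thesis unfolding antimagic_def by blast
qed

lemma tau_eq:
  assumes "\<And>t. antimagic (disjoint_union G (copies t (path_graph 3))) \<longleftrightarrow> t \<le> K"
  shows "tau G = ereal (real K)"
proof -
  have "antimagic G"
    using assms[of 0] antimagic_disjoint_union_no_copies by blast
  moreover have "(GREATEST t. \<forall>t'\<le>t. antimagic (disjoint_union G (copies t' (path_graph 3)))) = K"
    unfolding assms by (rule Greatest_equality) auto
  ultimately show ?thesis by (simp add: tau_def)
qed

lemma inj_pendant: "inj_on (\<lambda>(i, j). {Inl i, Inr (i, j)} :: (nat + nat \<times> nat) set) A"
  by (auto simp: inj_on_def doubleton_eq_iff)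

lemma cycle3_edges: "(\<lambda>i. Inl ` {i, Suc i mod 3}) ` {..<3} =
    ({{Inl 0, Inl 1}, {Inl 1, Inl 2}, {Inl 2, Inl 0}} :: (nat + 'b) set set)"
  unfolding lessThan_3 by (simp add: numeral_2_eq_2)

lemma card_cycle3_edges: "card ({{Inl 0, Inl 1}, {Inl 1, Inl 2}, {Inl 2, Inl 0}} :: (nat + 'b) set set) = 3"
  by (simp add: doubleton_eq_iff)

lemma card_edges_jellyfish: "card (edges (jellyfish 3 r)) = 3 * r + 3"
proof -
  have "card ((\<lambda>(i, j). {Inl i, Inr (i, j)} :: (nat + nat \<times> nat) set) ` ({..<3} \<times> {..<r})) = 3 * r"
    by (simp add: card_image[OF inj_pendant] card_cartesian_product)
  moreover have "{{Inl 0, Inl 1}, {Inl 1, Inl 2}, {Inl 2, Inl 0}} \<inter>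
      (\<lambda>(i, j). {Inl i, Inr (i, j)} :: (nat + nat \<times> nat) set) ` ({..<3} \<times> {..<r}) = {}"
    by (auto simp: doubleton_eq_iff)
  ultimately show ?thesis
    unfolding edges_jellyfish cycle3_edges
    by (subst card_Un_disjoint) (simp_all only: card_cycle3_edges finite_insert finite.emptyI, simp_all)
qed

lemma card_verts_jellyfish: "card (verts (jellyfish 3 r)) = 3 * r + 3"
  by (simp add: verts_jellyfish card_Plus card_cartesian_product)

lemma internal_edges_jellyfish:
  assumes "r \<ge> 1"
  shows "internal_edges (jellyfish 3 r) = {{Inl 0, Inl 1}, {Inl 1, Inl 2}, {Inl 2, Inl 0}}" (is "_ = ?C")
proof -
  let ?G = "jellyfish 3 r" and ?P = "(\<lambda>(i, j). {Inl i, Inr (i, j)} :: (nat + nat \<times> nat) set) ` ({..<3} \<times> {..<r})"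
  have E: "edges ?G = ?C \<union> ?P" by (simp only: edges_jellyfish cycle3_edges)
  have leaf: "degree ?G (Inr (i, j)) = 1" if "i < 3" "j < r" for i j
  proof -
    have "{e \<in> edges ?G. Inr (i, j) \<in> e} = {{Inl i, Inr (i, j)}}"
      unfolding E using that by auto
    then show ?thesis by (simp add: degree_def)
  qed
  have hub: "degree ?G (Inl i) \<noteq> 1" if "i < 3" for i
  proof
    assume "degree ?G (Inl i) = 1"
    then obtain e where e: "{e \<in> edges ?G. Inl i \<in> e} = {e}"
      unfolding degree_def by (rule card_1_singletonE)
    have unique: "x = e" if "x \<in> edges ?G" "Inl i \<in> x" for x
      using that e by blast
    have "{Inl i, Inr (i, 0)} = e"
      using that assms by (intro unique pendant_edge_jellyfish) auto
    moreover have "Inl ` {i, Suc i mod 3} = e"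
    proof (rule unique)
      show "Inl ` {i, Suc i mod 3} \<in> edges ?G"
        unfolding edges_jellyfish using that by blast
    qed simp
    moreover have "Inr (i, 0) \<notin> Inl ` {i, Suc i mod 3}" by blast
    ultimately show False by blast
  qed
  have squeeze: "A = C" if "A \<subseteq> C \<union> P" "C \<subseteq> A" "A \<inter> P = {}" for A C P :: "(nat + nat \<times> nat) set set"
    using that by blast
  show ?thesis
  proof (rule squeeze)
    show "internal_edges ?G \<subseteq> ?C \<union> ?P"
      unfolding E[symmetric] by (auto simp: internal_edges_def)
    show "?C \<subseteq> internal_edges ?G"
      using hub[of 0] hub[of 1] hub[of 2] by (auto simp: internal_edges_def E)
    show "internal_edges ?G \<inter> ?P = {}"
      using leaf by (auto simp: internal_edges_def)
  qed
qed

text \<open>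
  Every component contains a hub, the next hub and two leaves, hence at least four vertices.
\<close>

lemma jellyfish_no_P3_component:
  assumes "r \<ge> 2" "C \<in> components (jellyfish 3 r)"
  shows "\<not> isomorphic C (path_graph 3)"
proof
  let ?G = "jellyfish 3 r"
  let ?R = "(adj_rel ?G)\<^sup>*"
  assume "isomorphic C (path_graph 3)"
  then obtain h :: "nat + nat \<times> nat \<Rightarrow> nat" where "bij_betw h (verts C) {..<3}"
    by (auto simp: isomorphic_def path_graph_def)
  then have three: "finite (verts C)" "card (verts C) = 3"
    using bij_betw_finite bij_betw_same_card by fastforce+
  obtain v where v: "v \<in> verts ?G" and C: "verts C = ?R `` {v}"
    using assms(2) by (auto simp: components_def induced_subgraph_def)
  have pend: "{Inl i, Inr (i, j)} \<in> edges ?G" if "i < 3" "j < r" for i j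
    using that by (rule pendant_edge_jellyfish)
  have "\<exists>i<3. (v, Inl i) \<in> ?R"
  proof (cases v)
    case (Inl i)
    then show ?thesis using v by (auto simp: verts_jellyfish)
  next
    case (Inr p)
    obtain i j where p: "p = (i, j)" by fastforce
    then have "i < 3" "j < r" using v Inr by (auto simp: verts_jellyfish)
    then have "(v, Inl i) \<in> adj_rel ?G"
      using pend[of i j] Inr p by (simp add: adj_rel_def insert_commute)
    with \<open>i < 3\<close> show ?thesis by blast
  qed
  then obtain i where i: "i < 3" "(v, Inl i) \<in> ?R" by blast
  have "Inl ` {i, Suc i mod 3} \<in> edges ?G"
    unfolding edges_jellyfish using i(1) by blast
  then have "(Inl i, Inl (Suc i mod 3)) \<in> adj_rel ?G" by (simp add: adj_rel_def)
  moreover have "(Inl i, Inr (i, 0)) \<in> adj_rel ?G" "(Inl i, Inr (i, 1)) \<in> adj_rel ?G"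
    using pend i(1) assms(1) by (simp_all add: adj_rel_def)
  ultimately have sub: "{Inl i, Inl (Suc i mod 3), Inr (i, 0), Inr (i, 1)} \<subseteq> verts C"
    using i(2) unfolding C by (auto intro: rtrancl_into_rtrancl)
  have "i \<noteq> Suc i mod 3" using i(1) by (cases "Suc i = 3") auto
  then have "card {Inl i, Inl (Suc i mod 3), Inr (i, 0), Inr (i, 1) :: nat + nat \<times> nat} = 4" by simp
  then show False using card_mono[OF three(1) sub] three(2) by simp
qed

text \<open>
  As many edges as vertices make the term \<open>m - n\<close> vanish, so the minimum is between
  \<open>(1 + sqrt 2) * (3 * r + 7 / 2)\<close> and \<open>6 * r + 22\<close>. At \<open>r = 11\<close> these are about \<open>88.12\<close> and \<open>88\<close>,
  so the bound \<open>1.412\<close> for the square root is good enough.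
\<close>

lemma beta_jellyfish:
  assumes "r \<ge> 11"
  shows "beta (jellyfish 3 r) = 6 * int r + 22"
proof -
  let ?G = "jellyfish 3 r"
  have no_P3: "{C \<in> components ?G. isomorphic C (path_graph 3)} = {}"
    using jellyfish_no_P3_component[of r] assms by auto
  have internal: "card (internal_edges ?G) = 3"
  proof -
    have "1 \<le> r" using assms by simp
    then show ?thesis by (simp only: internal_edges_jellyfish card_cycle3_edges)
  qed
  have "1.412 \<le> sqrt 2" by (rule real_le_rsqrt) (simp add: power2_eq_square)
  then have "(1 + 1.412) * (3 * real r + 3 + 1 / 2) \<le> (1 + sqrt 2) * (3 * real r + 3 + 1 / 2)"
    by (intro mult_right_mono) auto
  moreover have "6 * real r + 22 \<le> (1 + 1.412) * (3 * real r + 3 + 1 / 2)"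
    using assms by simp
  ultimately have le: "6 * real r + 22 \<le> (1 + sqrt 2) * (3 * real r + 3 + 1 / 2)" by linarith
  have "beta ?G = \<lfloor>min ((1 + sqrt 2) * (3 * real r + 3 + 1 / 2)) (6 * real r + 22)\<rfloor>"
    unfolding beta_def card_verts_jellyfish card_edges_jellyfish internal no_P3
    by (simp add: add_divide_distrib algebra_simps)
  also have "\<dots> = \<lfloor>6 * real r + 22\<rfloor>"
    using le by (simp add: min_def)
  also have "\<dots> = 6 * int r + 22" by linarith
  finally show ?thesis .
qed

theorem theorem9:
  fixes r :: nat
  assumes "r \<ge> 11"
  shows "(\<forall>t::nat. antimagic (disjoint_union (jellyfish 3 r) (copies t (path_graph 3)))
                     \<longleftrightarrow> t \<le> 6 * r + 22)
         \<and> ereal (real_of_int (beta (jellyfish 3 r))) = tau (jellyfish 3 r)"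
proof (intro conjI allI)
  show iff: "antimagic (jellyfish_paths r t) \<longleftrightarrow> t \<le> 6 * r + 22" for t
    using assms by (rule antimagic_jellyfish_paths)
  show "ereal (real_of_int (beta (jellyfish 3 r))) = tau (jellyfish 3 r)"
    unfolding tau_eq[OF iff] beta_jellyfish[OF assms] by simp
qed

end
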